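(* Let $n\ge 2$, let $P_n$ be the path on $n$ vertices $x_1,\ldots,x_n$, let $K$ be a field and let $I=I(P_n)\subset S=K[x_1,\ldots,x_n]$ be its edge ideal. Then $\mathrm v (I^{k})=2k-1$ for all $k\ge 1$ with $k\geq \lfloor\frac{n}{2}\rfloor-1$.
   Context: $S=\bigoplus_{d\ge 0}S_d$ is graded with $\deg x_i=1$. $P_n$ has edges $\{x_i,x_{i+1}\}$ for $1\le i<n$, so $I(P_n)=\langle x_ix_{i+1}\mid 1\le i<n\rangle$. For a proper graded ideal $I\subset S$, $\mathrm{v}(I):=\min\{d\geq 0\mid \exists f\in S_d,\ \mathfrak{p}\in\operatorname{Ass}(I)\text{ with }(I:f)=\mathfrak{p}\}$, where $\operatorname{Ass}(I)$ is the set of associated primes of $S/I$ and $(I:f)=\{g\in S\mid gf\in I\}$. *)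

theory Defs
  imports
    "HOL-Library.Poly_Mapping"
    "HOL-Algebra.QuotRing"
    "HOL-Algebra.Ideal_Product"
begin

section \<open>The polynomial ring $K[x_1,\dots,x_n]$\<close>

text \<open>
  A polynomial is a finitely supported map from monomials to coefficients, a monomial being a
  finitely supported map from variable indices to exponents. The type has a variable for every
  natural number; \<open>poly_ring n\<close> is the subring of polynomials involving only the variables with
  indices \<open>1, \<dots>, n\<close>.
\<close>

type_synonym 'k mpoly = "(nat \<Rightarrow>\<^sub>0 nat) \<Rightarrow>\<^sub>0 'k"

definition poly_ring :: "nat \<Rightarrow> 'k::field mpoly ring"
  where "poly_ring n = \<lparr> carrier = {p. \<forall>m \<in> Poly_Mapping.keys p. Poly_Mapping.keys m \<subseteq> {1..n}},
                        mult = (*), one = 1, zero = 0, add = (+) \<rparr>"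

definition var :: "nat \<Rightarrow> 'k::field mpoly"
  where "var i = Poly_Mapping.single (Poly_Mapping.single i 1) 1"

definition monom_degree :: "(nat \<Rightarrow>\<^sub>0 nat) \<Rightarrow> nat"
  where "monom_degree m = (\<Sum>i \<in> Poly_Mapping.keys m. Poly_Mapping.lookup m i)"

text \<open>The graded component $S_d$ (it contains 0 for every \<open>d\<close>).\<close>

definition graded_part :: "nat \<Rightarrow> nat \<Rightarrow> 'k::field mpoly set"
  where "graded_part n d =
    {p \<in> carrier (poly_ring n). \<forall>m \<in> Poly_Mapping.keys p. monom_degree m = d}"

text \<open>\<open>poly_ring n\<close> really is a commutative ring, so that the notions of ideal, generated ideal
  and ideal product from the library have their usual meaning in it.\<close>

lemma cring_poly_ring: "cring (poly_ring n :: 'k::field mpoly ring)"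
proof (rule cringI)
  let ?S = "poly_ring n :: 'k mpoly ring"
  have in_S: "p \<in> carrier ?S \<longleftrightarrow>
      (\<forall>m \<in> Poly_Mapping.keys p. Poly_Mapping.keys m \<subseteq> {1..n})" for p
    by (simp add: poly_ring_def)
  have ops: "p \<oplus>\<^bsub>?S\<^esub> q = p + q" "p \<otimes>\<^bsub>?S\<^esub> q = p * q" "\<zero>\<^bsub>?S\<^esub> = 0" "\<one>\<^bsub>?S\<^esub> = 1" for p q
    by (simp_all add: poly_ring_def)
  have add: "p + q \<in> carrier ?S" if "p \<in> carrier ?S" "q \<in> carrier ?S" for p q
    using that Poly_Mapping.keys_add[of p q] unfolding in_S by blast
  have mult: "p * q \<in> carrier ?S" if pq: "p \<in> carrier ?S" "q \<in> carrier ?S" for p q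
    unfolding in_S
  proof
    fix m assume "m \<in> Poly_Mapping.keys (p * q)"
    then obtain a b where "m = a + b" "a \<in> Poly_Mapping.keys p" "b \<in> Poly_Mapping.keys q"
      using Poly_Mapping.keys_mult[of p q] by blast
    moreover from this pq have "Poly_Mapping.keys a \<subseteq> {1..n}" "Poly_Mapping.keys b \<subseteq> {1..n}"
      unfolding in_S by blast+
    ultimately show "Poly_Mapping.keys m \<subseteq> {1..n}"
      using Poly_Mapping.keys_add[of a b] by blast
  qed
  have zero: "0 \<in> carrier ?S" and one: "1 \<in> carrier ?S"
    by (simp_all add: in_S)
  show "abelian_group ?S"
  proof (rule abelian_groupI)
    fix p assume "p \<in> carrier ?S"
    then have "- p \<in> carrier ?S" by (simp add: in_S)
    then show "\<exists>q\<in>carrier ?S. q \<oplus>\<^bsub>?S\<^esub> p = \<zero>\<^bsub>?S\<^esub>"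
      unfolding ops by (intro bexI[of _ "- p"]) simp_all
  qed (simp_all add: ops add zero add.assoc add.commute)
  show "Group.comm_monoid ?S"
    by (rule comm_monoidI) (simp_all add: ops mult one mult.assoc mult.commute)
  show "(p \<oplus>\<^bsub>?S\<^esub> q) \<otimes>\<^bsub>?S\<^esub> r = p \<otimes>\<^bsub>?S\<^esub> r \<oplus>\<^bsub>?S\<^esub> q \<otimes>\<^bsub>?S\<^esub> r" for p q r
    unfolding ops by (rule distrib_right)
qed


section \<open>Colon ideals, associated primes and the v-number\<close>

definition colon :: "('a, 'b) ring_scheme \<Rightarrow> 'a set \<Rightarrow> 'a \<Rightarrow> 'a set"
  where "colon R I f = {g \<in> carrier R. g \<otimes>\<^bsub>R\<^esub> f \<in> I}"

text \<open>The associated primes of the \<open>R\<close>-module \<open>R/I\<close>: the prime ideals of \<open>R\<close> that are annihilators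
  of an element \<open>x\<close> of \<open>R/I\<close>, where \<open>r \<in> R\<close> acts as multiplication by its residue class.\<close>

definition assoc_primes :: "('a, 'b) ring_scheme \<Rightarrow> 'a set \<Rightarrow> 'a set set"
  where "assoc_primes R I =
    {P. primeideal P R \<and>
        (\<exists>x \<in> carrier (R Quot I).
           P = {r \<in> carrier R. (I +>\<^bsub>R\<^esub> r) \<otimes>\<^bsub>R Quot I\<^esub> x = \<zero>\<^bsub>R Quot I\<^esub>})}"

definition v_number :: "nat \<Rightarrow> 'k::field mpoly set \<Rightarrow> nat"
  where "v_number n I =
    (LEAST d. \<exists>f \<in> graded_part n d. \<exists>P \<in> assoc_primes (poly_ring n) I. colon (poly_ring n) I f = P)"


section \<open>Edge ideals\<close>

text \<open>The edge ideal of the graph with vertex set \<open>{1..n}\<close> and edge set \<open>E\<close>, edges being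
  two-element sets.\<close>

definition edge_ideal :: "nat \<Rightarrow> nat set set \<Rightarrow> 'k::field mpoly set"
  where "edge_ideal n E = genideal (poly_ring n) {var i * var j | i j. {i, j} \<in> E}"

definition path_edges :: "nat \<Rightarrow> nat set set"
  where "path_edges n = {{i, i + 1} | i. 1 \<le> i \<and> i < n}"

text \<open>Powers of ideals are powers in the monoid of ideals under the ideal product.\<close>

definition ideal_power :: "nat \<Rightarrow> 'k::field mpoly set \<Rightarrow> nat \<Rightarrow> 'k mpoly set"
  where "ideal_power n I k = I [^]\<^bsub>ideals_set (poly_ring n)\<^esub> k"

end

theory Submission
  imports Defs
begin

text \<open>
  Let \<open>m = n div 2\<close>, so that the even vertices are \<open>2, 4, \<dots>, 2 m\<close>.

  Lower bound. Suppose that \<open>P = (I\<^sup>k : f)\<close> is prime with \<open>f\<close> homogeneous of degree \<open>d\<close>. Then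
  \<open>P\<close> contains \<open>I\<^sup>k\<close>, hence \<open>I\<close>, hence \<open>x\<^sub>1 x\<^sub>2\<close>, hence one of the variables \<open>x\<^sub>1, x\<^sub>2\<close>. Its product
  with \<open>f\<close> is a nonzero element of \<open>I\<^sup>k\<close>, homogeneous of degree \<open>d + 1\<close>, whereas \<open>I\<^sup>k\<close> is
  generated in degree \<open>2 k\<close> (lemma \<open>prime_colon_degree_bound\<close>).

  Upper bound. The even vertices form a vertex cover, so every monomial of \<open>I\<^sup>k\<close> has degree at
  least \<open>k\<close> in the even variables. Consequently \<open>(I\<^sup>k : f)\<close> is contained in the prime
  \<open>P = (x\<^sub>2, x\<^sub>4, \<dots>)\<close> for every monomial \<open>f\<close> of degree \<open>k - 1\<close> in the even variables. It remains
  to choose such an \<open>f\<close> of degree \<open>2 k - 1\<close> that is multiplied into \<open>I\<^sup>k\<close> by each even variable. The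
  choice for \<open>n \<ge> 4\<close> is
    \<open>f = x\<^sub>3 \<cdot> (x\<^sub>2 x\<^sub>3)\<^sup>a \<cdot> (x\<^sub>4 x\<^sub>5) (x\<^sub>6 x\<^sub>7) \<cdots> (x\<^bsub>2m-2\<^esub> x\<^bsub>2m-1\<^esub>)\<close>
  with \<open>a = k - 1 - (m - 2)\<close>; this exponent is a natural number exactly because \<open>k \<ge> m - 1\<close>.
  Multiplying \<open>f\<close> by \<open>x\<^bsub>2j\<^esub>\<close> allows the pairs up to \<open>j\<close> to be shifted by one place along the path:
    \<open>x\<^sub>3 (x\<^sub>4 x\<^sub>5) \<cdots> (x\<^bsub>2j-2\<^esub> x\<^bsub>2j-1\<^esub>) x\<^bsub>2j\<^esub> = (x\<^sub>3 x\<^sub>4) (x\<^sub>5 x\<^sub>6) \<cdots> (x\<^bsub>2j-1\<^esub> x\<^bsub>2j\<^esub>)\<close>,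
  so the product is a product of \<open>k\<close> edges (lemma \<open>even_var_times_witness\<close>). For \<open>n \<le> 3\<close> there is
  a single even vertex, and \<open>x\<^sub>1\<close> takes the place of \<open>x\<^sub>3\<close>.
\<close>

section \<open>Monomials and the ambient polynomial ring\<close>

abbreviation xexp :: "nat \<Rightarrow> (nat \<Rightarrow>\<^sub>0 nat)"
  where "xexp i \<equiv> Poly_Mapping.single i 1"

abbreviation monomial :: "(nat \<Rightarrow>\<^sub>0 nat) \<Rightarrow> 'k::field mpoly"
  where "monomial m \<equiv> Poly_Mapping.single m 1"

lemma in_poly_ring:
  "p \<in> carrier (poly_ring n) \<longleftrightarrow>
     (\<forall>m \<in> Poly_Mapping.keys p. Poly_Mapping.keys m \<subseteq> {1..n})"
  by (simp add: poly_ring_def)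

lemma poly_ring_ops [simp]:
  "p \<oplus>\<^bsub>poly_ring n\<^esub> q = p + q" "p \<otimes>\<^bsub>poly_ring n\<^esub> q = p * q"
  "\<zero>\<^bsub>poly_ring n\<^esub> = 0" "\<one>\<^bsub>poly_ring n\<^esub> = 1"
  by (simp_all add: poly_ring_def)

lemma var_in_poly_ring: "1 \<le> i \<Longrightarrow> i \<le> n \<Longrightarrow> var i \<in> carrier (poly_ring n)"
  by (auto simp: in_poly_ring var_def)

lemma keys_add_nat:
  "Poly_Mapping.keys (a + b) = Poly_Mapping.keys a \<union> Poly_Mapping.keys (b :: nat \<Rightarrow>\<^sub>0 nat)"
  by (auto simp: in_keys_iff lookup_add)

lemma keys_monomial_mult:
  "Poly_Mapping.keys (Poly_Mapping.single m c * p) = (+) m ` Poly_Mapping.keys p"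
  if "c \<noteq> 0" for p :: "'k::field mpoly"
proof -
  have lk: "Poly_Mapping.lookup (Poly_Mapping.single m c * p) (m + t)
      = c * Poly_Mapping.lookup p t" for t
    unfolding lookup_mult lookup_single by (simp add: when_mult)
  have "Poly_Mapping.keys (Poly_Mapping.single m c * p) \<subseteq> (+) m ` Poly_Mapping.keys p"
    using keys_mult[of "Poly_Mapping.single m c" p] that by auto
  moreover have "(+) m ` Poly_Mapping.keys p \<subseteq> Poly_Mapping.keys (Poly_Mapping.single m c * p)"
    using that by (auto simp: in_keys_iff lk)
  ultimately show ?thesis by blast
qed

lemma sum_mem_ideal:
  assumes "ideal J (poly_ring n)" and "\<And>x. x \<in> A \<Longrightarrow> f x \<in> J"
  shows "sum f A \<in> (J :: 'k::field mpoly set)"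
proof -
  have J: "additive_subgroup J (poly_ring n)" using assms(1) by (rule ideal.axioms(1))
  have zero: "0 \<in> J" using additive_subgroup.zero_closed[OF J] by simp
  have add: "p + q \<in> J" if "p \<in> J" "q \<in> J" for p q
    using additive_subgroup.a_closed[OF J that] by simp
  show ?thesis
    using assms(2) by (induction A rule: infinite_finite_induct) (auto intro: zero add)
qed

lemma poly_mapping_sum_singles:
  "p = (\<Sum>m \<in> Poly_Mapping.keys p. Poly_Mapping.single m (Poly_Mapping.lookup p m))"
  by (rule poly_mapping_eqI) (auto simp: lookup_sum lookup_single when_def in_keys_iff)


section \<open>Ideals of polynomials of high order in a set of variables\<close>

definition degree_in :: "nat set \<Rightarrow> (nat \<Rightarrow>\<^sub>0 nat) \<Rightarrow> nat"
  where "degree_in A m = (\<Sum>i \<in> Poly_Mapping.keys m \<inter> A. Poly_Mapping.lookup m i)"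

lemma degree_in_UNIV: "degree_in UNIV = monom_degree"
  by (simp add: degree_in_def monom_degree_def fun_eq_iff)

lemma degree_in_add: "degree_in A (a + b) = degree_in A a + degree_in A b"
proof -
  let ?S = "(Poly_Mapping.keys a \<union> Poly_Mapping.keys b) \<inter> A"
  have ext: "degree_in A m = (\<Sum>i \<in> ?S. Poly_Mapping.lookup m i)"
    if "Poly_Mapping.keys m \<subseteq> Poly_Mapping.keys a \<union> Poly_Mapping.keys b" for m
    unfolding degree_in_def using that
    by (intro sum.mono_neutral_left) (auto simp: in_keys_iff)
  show ?thesis
    by (simp add: ext keys_add_nat lookup_add sum.distrib)
qed

lemma degree_in_zero [simp]: "degree_in A 0 = 0"
  by (simp add: degree_in_def)

lemma degree_in_sum: "degree_in A (\<Sum>i\<in>T. g i) = (\<Sum>i\<in>T. degree_in A (g i))"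
  by (induction T rule: infinite_finite_induct) (auto simp: degree_in_add)

lemma degree_in_xexp: "degree_in A (xexp i) = (if i \<in> A then 1 else 0)"
  by (simp add: degree_in_def)

text \<open>The \<open>d\<close>-th power of the prime ideal generated by the variables in \<open>A\<close>, described by its
  monomials. It serves both for the total degree, where \<open>A\<close> is everything, and for the degree in
  the vertices of a vertex cover.\<close>

definition order_ideal :: "nat \<Rightarrow> nat set \<Rightarrow> nat \<Rightarrow> 'k::field mpoly set"
  where "order_ideal n A d =
    {p \<in> carrier (poly_ring n). \<forall>m \<in> Poly_Mapping.keys p. d \<le> degree_in A m}"

lemma order_ideal_add:
  "p \<in> order_ideal n A d \<Longrightarrow> q \<in> order_ideal n A d \<Longrightarrow> p + q \<in> order_ideal n A d"
  using Poly_Mapping.keys_add[of p q] unfolding order_ideal_def in_poly_ring by blast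

lemma order_ideal_mult:
  fixes p q :: "'k::field mpoly"
  assumes "p \<in> order_ideal n A c" "q \<in> order_ideal n A d"
  shows "p * q \<in> order_ideal n A (c + d)"
proof -
  interpret R: cring "poly_ring n :: 'k mpoly ring" by (rule cring_poly_ring)
  have "p * q \<in> carrier (poly_ring n)"
    using assms R.m_closed[of p q] by (simp add: order_ideal_def)
  moreover have "c + d \<le> degree_in A m" if m: "m \<in> Poly_Mapping.keys (p * q)" for m
  proof -
    obtain a b where "m = a + b" "a \<in> Poly_Mapping.keys p" "b \<in> Poly_Mapping.keys q"
      using m keys_mult[of p q] by blast
    then show ?thesis using assms by (auto simp: order_ideal_def degree_in_add intro: add_mono)
  qed
  ultimately show ?thesis by (simp add: order_ideal_def)
qed

lemma order_ideal_0: "order_ideal n A 0 = carrier (poly_ring n)"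
  by (simp add: order_ideal_def)

lemma ideal_order_ideal: "ideal (order_ideal n A d :: 'k::field mpoly set) (poly_ring n)"
proof -
  interpret R: cring "poly_ring n :: 'k mpoly ring" by (rule cring_poly_ring)
  have neg: "\<ominus>\<^bsub>poly_ring n\<^esub> p = - p" if "p \<in> carrier (poly_ring n)" for p :: "'k mpoly"
    using that by (intro R.minus_equality) (auto simp: in_poly_ring)
  have lmult: "x * p \<in> order_ideal n A d"
    if "p \<in> order_ideal n A d" "x \<in> carrier (poly_ring n)" for p x :: "'k mpoly"
    using order_ideal_mult[of x n A 0 p d] that by (simp add: order_ideal_0)
  show ?thesis
  proof (rule idealI)
    show "subgroup (order_ideal n A d) (add_monoid (poly_ring n :: 'k mpoly ring))"
    proof (rule R.add.subgroupI)
      show "order_ideal n A d \<subseteq> carrier (poly_ring n)" by (auto simp: order_ideal_def)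
      have "0 \<in> order_ideal n A d" by (simp add: order_ideal_def in_poly_ring)
      then show "order_ideal n A d \<noteq> {}" by blast
    next
      fix p :: "'k mpoly" assume "p \<in> order_ideal n A d"
      then show "\<ominus>\<^bsub>poly_ring n\<^esub> p \<in> order_ideal n A d"
        by (auto simp: order_ideal_def neg in_poly_ring)
    next
      fix p q :: "'k mpoly" assume "p \<in> order_ideal n A d" "q \<in> order_ideal n A d"
      then show "p \<oplus>\<^bsub>poly_ring n\<^esub> q \<in> order_ideal n A d"
        by (simp add: order_ideal_add)
    qed
  qed (use R.ring_axioms lmult in \<open>auto simp: mult.commute\<close>)
qed

text \<open>Modulo the variables in \<open>A\<close> every polynomial is represented by its part free of these
  variables, and the product of two nonzero such parts is again nonzero and free of them, since
  the polynomial ring is a domain.\<close>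

lemma primeideal_order_ideal_1:
  "primeideal (order_ideal n A 1 :: 'k::field mpoly set) (poly_ring n)"
proof (rule primeidealI)
  let ?P = "order_ideal n A 1 :: 'k mpoly set"
  let ?R = "poly_ring n :: 'k mpoly ring"
  show idl: "ideal ?P ?R" by (rule ideal_order_ideal)
  show "cring ?R" by (rule cring_poly_ring)
  have "1 \<in> carrier ?R" "1 \<notin> ?P" by (auto simp: in_poly_ring order_ideal_def)
  then show "carrier ?R \<noteq> ?P" by blast
  define avoids where "avoids q \<longleftrightarrow> (\<forall>m \<in> Poly_Mapping.keys q. degree_in A m = 0)"
    for q :: "'k mpoly"
  have split: "\<exists>q \<in> carrier ?R. avoids q \<and> p - q \<in> ?P" if p: "p \<in> carrier ?R" for p
  proof -
    define q where "q = (\<Sum>m \<in> {m \<in> Poly_Mapping.keys p. degree_in A m = 0}.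
      Poly_Mapping.single m (Poly_Mapping.lookup p m))"
    have lq: "Poly_Mapping.lookup q m = (if degree_in A m = 0 then Poly_Mapping.lookup p m else 0)"
      for m
      by (auto simp: q_def lookup_sum lookup_single when_def in_keys_iff)
    have "Poly_Mapping.keys q \<subseteq> Poly_Mapping.keys p"
      "Poly_Mapping.keys (p - q) \<subseteq> Poly_Mapping.keys p"
      by (auto simp: in_keys_iff lq lookup_minus split: if_splits)
    moreover have "avoids q" unfolding avoids_def
      by (auto simp: in_keys_iff lq split: if_splits)
    moreover have "1 \<le> degree_in A m" if "m \<in> Poly_Mapping.keys (p - q)" for m
      using that by (cases "degree_in A m = 0") (auto simp: in_keys_iff lq lookup_minus)
    ultimately show ?thesis
      using p by (intro bexI[of _ q]) (auto simp: order_ideal_def in_poly_ring)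
  qed
  fix a b :: "'k mpoly"
  assume ab: "a \<in> carrier ?R" "b \<in> carrier ?R" "a \<otimes>\<^bsub>?R\<^esub> b \<in> ?P"
  obtain a' b' where a': "a' \<in> carrier ?R" "avoids a'" "a - a' \<in> ?P"
    and b': "b' \<in> carrier ?R" "avoids b'" "b - b' \<in> ?P"
    using split ab by meson
  have lmult: "x * p \<in> ?P" if "p \<in> ?P" "x \<in> carrier ?R" for p x
    using ideal.I_l_closed[OF idl that] by simp
  have "(- a') * (b - b') \<in> ?P" using a' b' by (intro lmult) (auto simp: in_poly_ring)
  moreover have "(- b) * (a - a') \<in> ?P" using a' ab by (intro lmult) (auto simp: in_poly_ring)
  moreover have "a' * b' = a * b + ((- a') * (b - b') + (- b) * (a - a'))"
    by (simp add: algebra_simps)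
  ultimately have "a' * b' \<in> ?P"
    using ab(3) by (metis order_ideal_add poly_ring_ops(2))
  moreover have "degree_in A m = 0" if "m \<in> Poly_Mapping.keys (a' * b')" for m
    using that keys_mult[of a' b'] a'(2) b'(2) unfolding avoids_def
    by (fastforce simp: degree_in_add)
  ultimately have "Poly_Mapping.keys (a' * b') = {}" by (force simp: order_ideal_def)
  then have "a' = 0 \<or> b' = 0" by simp
  then show "a \<in> ?P \<or> b \<in> ?P" using a' b' by auto
qed

section \<open>Powers of ideals\<close>

lemma ideal_power_0: "ideal_power n I 0 = carrier (poly_ring n)"
  by (simp add: ideal_power_def ideals_set_def nat_pow_def)

lemma ideal_power_Suc: "ideal_power n I (Suc k) = ideal_prod (poly_ring n) (ideal_power n I k) I"
  by (simp add: ideal_power_def ideals_set_def nat_pow_def)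

lemma ideal_ideal_power:
  assumes "ideal I (poly_ring n)"
  shows "ideal (ideal_power n I k :: 'k::field mpoly set) (poly_ring n)"
proof -
  interpret R: cring "poly_ring n :: 'k mpoly ring" by (rule cring_poly_ring)
  show ?thesis
    by (induction k)
      (simp_all add: ideal_power_0 ideal_power_Suc R.oneideal R.ideal_prod_is_ideal assms)
qed

lemma mult_mem_ideal_power_Suc:
  "p \<in> ideal_power n I k \<Longrightarrow> q \<in> I \<Longrightarrow> p * q \<in> ideal_power n I (Suc k)"
  using ideal_prod.prod[of p "ideal_power n I k" q I "poly_ring n"]
  by (simp add: ideal_power_Suc)

lemma power_mem_ideal_power: "p \<in> I \<Longrightarrow> p ^ k \<in> ideal_power n I k"
proof (induction k)
  case 0
  then show ?case by (simp add: ideal_power_0 in_poly_ring)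
next
  case (Suc k)
  then show ?case using mult_mem_ideal_power_Suc[of "p ^ k" n I k p] by (simp add: mult.commute)
qed

lemma ideal_power_subset_order_ideal:
  assumes "I \<subseteq> order_ideal n A c"
  shows "ideal_power n I k \<subseteq> order_ideal n A (c * k)"
proof (induction k)
  case 0
  then show ?case by (simp add: ideal_power_0 order_ideal_0)
next
  case (Suc k)
  have "p \<in> order_ideal n A (c * Suc k)"
    if "p \<in> ideal_prod (poly_ring n) (ideal_power n I k) I" for p
    using that
  proof induction
    case (prod i j)
    then show ?case
      using order_ideal_mult[of i n A "c * k" j c] Suc assms by (auto simp: add.commute)
  next
    case (sum p q)
    then show ?case by (simp add: order_ideal_add)
  qed
  then show ?case by (auto simp: ideal_power_Suc)
qed


section \<open>Colon ideals that are prime\<close>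

lemma power_mem_primeideal:
  assumes "primeideal P (poly_ring n)" "p \<in> carrier (poly_ring n)" "p ^ k \<in> P"
  shows "(p :: 'k::field mpoly) \<in> P"
proof -
  interpret P: primeideal P "poly_ring n" by fact
  have "1 \<notin> P" using P.one_imp_carrier P.I_notcarr by auto
  moreover have "p ^ j \<in> carrier (poly_ring n)" for j
    by (induction j) (use P.m_closed P.one_closed assms(2) in auto)
  ultimately show ?thesis
    using assms(3) by (induction k) (use P.I_prime assms(2) in auto)
qed

text \<open>The residue class of \<open>f\<close> modulo \<open>J\<close> is an element of the quotient with annihilator
  \<open>(J : f)\<close>.\<close>

lemma prime_colon_in_assoc_primes:
  assumes "cring R" "ideal J R" "f \<in> carrier R" "primeideal (colon R J f) R"
  shows "colon R J f \<in> assoc_primes R J"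
proof -
  interpret R: cring R by fact
  interpret J: ideal J R by fact
  have "J +>\<^bsub>R\<^esub> f \<in> carrier (R Quot J)"
    using assms(3) by (auto simp: FactRing_def A_RCOSETS_def')
  moreover have "(J +>\<^bsub>R\<^esub> r) \<otimes>\<^bsub>R Quot J\<^esub> (J +>\<^bsub>R\<^esub> f) = \<zero>\<^bsub>R Quot J\<^esub>
      \<longleftrightarrow> r \<otimes>\<^bsub>R\<^esub> f \<in> J" if r: "r \<in> carrier R" for r
  proof -
    have rf: "r \<otimes>\<^bsub>R\<^esub> f \<in> carrier R" using r assms(3) by (rule R.m_closed)
    have "(J +>\<^bsub>R\<^esub> r) \<otimes>\<^bsub>R Quot J\<^esub> (J +>\<^bsub>R\<^esub> f) = J +>\<^bsub>R\<^esub> (r \<otimes>\<^bsub>R\<^esub> f)"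
      unfolding FactRing_def using J.rcoset_mult_add[OF r assms(3)] by simp
    moreover have "\<zero>\<^bsub>R Quot J\<^esub> = J" by (simp add: FactRing_def)
    moreover have "J +>\<^bsub>R\<^esub> (r \<otimes>\<^bsub>R\<^esub> f) = J \<longleftrightarrow> r \<otimes>\<^bsub>R\<^esub> f \<in> J"
      using R.a_coset_join1[OF _ rf J.a_subgroup] R.a_coset_join2[OF rf J.a_subgroup] by blast
    ultimately show ?thesis by simp
  qed
  ultimately have "\<exists>x \<in> carrier (R Quot J). colon R J f =
      {r \<in> carrier R. (J +>\<^bsub>R\<^esub> r) \<otimes>\<^bsub>R Quot J\<^esub> x = \<zero>\<^bsub>R Quot J\<^esub>}"
    unfolding colon_def by (intro bexI[of _ "J +>\<^bsub>R\<^esub> f"] Collect_cong conj_cong) auto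
  then show ?thesis
    using assms(4) by (simp add: assoc_primes_def)
qed

text \<open>If a prime contains the power \<open>I\<^sup>k\<close> then it contains \<open>I\<close>, and then one factor of any
  product \<open>x\<^sub>i x\<^sub>j\<close> in \<open>I\<close>. Multiplication by this variable raises the degree of \<open>f\<close> by one only,
  yet it carries \<open>f\<close> to a nonzero element of \<open>I\<^sup>k\<close>.\<close>

lemma prime_colon_degree_bound:
  fixes I :: "'k::field mpoly set"
  assumes I: "ideal I (poly_ring n)" "I \<subseteq> order_ideal n UNIV 2"
    and edge: "1 \<le> i" "i \<le> n" "1 \<le> j" "j \<le> n" "var i * var j \<in> I"
    and f: "f \<in> graded_part n d"
    and P: "primeideal (colon (poly_ring n) (ideal_power n I k) f) (poly_ring n)"
  shows "2 * k \<le> d + 1"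
proof -
  let ?R = "poly_ring n :: 'k mpoly ring" and ?J = "ideal_power n I k"
  let ?P = "colon ?R ?J f"
  have mem_P: "g \<in> ?P \<longleftrightarrow> g \<in> carrier ?R \<and> g * f \<in> ?J" for g
    by (simp add: colon_def)
  interpret P: primeideal ?P ?R by (rule P)
  interpret J: ideal ?J ?R by (rule ideal_ideal_power[OF I(1)])
  have fR: "f \<in> carrier ?R" using f by (simp add: graded_part_def)
  have vars: "var i \<in> carrier ?R" "var j \<in> carrier ?R" by (rule var_in_poly_ring; fact edge)+
  have sub: "?J \<subseteq> ?P"
  proof
    fix p assume "p \<in> ?J"
    then show "p \<in> ?P"
      using J.I_r_closed[OF _ fR] J.Icarr unfolding mem_P poly_ring_ops by blast
  qed
  have "(var i * var j) ^ k \<in> ?P" using sub power_mem_ideal_power[OF edge(5)] by blast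
  moreover have "var i * var j \<in> carrier ?R" using P.m_closed[OF vars] by simp
  ultimately have "var i * var j \<in> ?P" using power_mem_primeideal[OF P] by blast
  then obtain l where l: "var l \<in> ?P" using P.I_prime[OF vars] by auto
  then have mem: "var l * f \<in> ?J" unfolding mem_P by blast
  have "f \<noteq> 0"
  proof
    assume "f = 0"
    then have "g * f \<in> ?J" for g
      using additive_subgroup.zero_closed[OF J.additive_subgroup_axioms] by simp
    then have "?P = carrier ?R" using mem_P by blast
    then show False using P.I_notcarr by blast
  qed
  then obtain m where m: "m \<in> Poly_Mapping.keys f" using keys_eq_empty[of f] by blast
  have "xexp l + m \<in> Poly_Mapping.keys (var l * f)"
    using m by (simp add: var_def keys_monomial_mult)
  moreover have "var l * f \<in> order_ideal n UNIV (2 * k)"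
    using ideal_power_subset_order_ideal[OF I(2)] mem by blast
  ultimately have "2 * k \<le> degree_in UNIV (xexp l + m)" by (auto simp: order_ideal_def)
  also have "\<dots> = 1 + monom_degree m"
    by (simp only: degree_in_add degree_in_xexp) (simp add: degree_in_UNIV)
  also have "monom_degree m = d" using f m by (simp add: graded_part_def)
  finally show ?thesis by simp
qed

text \<open>A monomial \<open>f\<close> of order \<open>c - 1\<close> along \<open>A\<close> cannot be multiplied into an ideal of order \<open>c\<close>
  by a polynomial with a monomial free of the variables in \<open>A\<close>. So as soon as these variables
  themselves belong to the colon ideal, they generate it.\<close>

lemma colon_eq_order_ideal_1:
  fixes J :: "'k::field mpoly set"
  assumes J: "ideal J (poly_ring n)" "J \<subseteq> order_ideal n A (Suc (degree_in A \<mu>))"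
    and \<mu>: "Poly_Mapping.keys \<mu> \<subseteq> {1..n}"
    and vars: "\<And>i. i \<in> A \<Longrightarrow> i \<in> {1..n} \<Longrightarrow> monomial (xexp i + \<mu>) \<in> J"
  shows "colon (poly_ring n) J (monomial \<mu>) = order_ideal n A 1"
proof (intro equalityI subsetI)
  fix g assume "g \<in> colon (poly_ring n) J (monomial \<mu>)"
  then have g: "g \<in> carrier (poly_ring n)" "monomial \<mu> * g \<in> J"
    by (auto simp: colon_def mult.commute)
  have "1 \<le> degree_in A m" if "m \<in> Poly_Mapping.keys g" for m
  proof -
    have "\<mu> + m \<in> Poly_Mapping.keys (monomial \<mu> * g)" using that by (simp add: keys_monomial_mult)
    with g(2) J(2) have "Suc (degree_in A \<mu>) \<le> degree_in A (\<mu> + m)"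
      by (auto simp: order_ideal_def)
    then show ?thesis by (simp add: degree_in_add)
  qed
  with g(1) show "g \<in> order_ideal n A 1" by (simp add: order_ideal_def)
next
  interpret J: ideal J "poly_ring n" by (rule J(1))
  fix g :: "'k mpoly" assume g: "g \<in> order_ideal n A 1"
  have term_mem: "Poly_Mapping.single m c * monomial \<mu> \<in> J"
    if m: "m \<in> Poly_Mapping.keys g" for m and c :: 'k
  proof -
    have mn: "Poly_Mapping.keys m \<subseteq> {1..n}" and "1 \<le> degree_in A m"
      using g m by (auto simp: order_ideal_def in_poly_ring)
    then obtain i where i: "i \<in> Poly_Mapping.keys m" "i \<in> A"
      unfolding degree_in_def by (metis IntE ex_in_conv not_one_le_zero sum.empty)
    have m_eq: "m = (m - xexp i) + xexp i"
      using i(1) by (intro poly_mapping_eqI)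
        (auto simp: lookup_add lookup_minus lookup_single when_def in_keys_iff)
    have "Poly_Mapping.keys (m - xexp i) \<subseteq> Poly_Mapping.keys m"
      by (subst (2) m_eq) (simp only: keys_add_nat, blast)
    then have "Poly_Mapping.single (m - xexp i) c \<in> carrier (poly_ring n)"
      using mn by (auto simp: in_poly_ring)
    then have "Poly_Mapping.single (m - xexp i) c * monomial (xexp i + \<mu>) \<in> J"
      using J.I_l_closed vars i mn by (metis poly_ring_ops(2) subsetD)
    also have "Poly_Mapping.single (m - xexp i) c * monomial (xexp i + \<mu>)
        = Poly_Mapping.single m c * monomial \<mu>"
      unfolding mult_single add.assoc[symmetric] m_eq[symmetric] by simp
    finally show ?thesis .
  qed
  have "g * monomial \<mu> = (\<Sum>m \<in> Poly_Mapping.keys g.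
      Poly_Mapping.single m (Poly_Mapping.lookup g m) * monomial \<mu>)"
    by (subst poly_mapping_sum_singles[of g]) (simp add: sum_distrib_right)
  also have "\<dots> \<in> J" by (intro sum_mem_ideal[OF J(1)] term_mem)
  finally show "g \<in> colon (poly_ring n) J (monomial \<mu>)"
    using g by (simp add: colon_def order_ideal_def)
qed


section \<open>Edge ideals of paths\<close>

lemma var_mult_var: "var i * var j = monomial (xexp i + xexp j)"
  by (simp add: var_def mult_single)

lemma path_edge_generators:
  "{var i * var j | i j. {i, j} \<in> path_edges n}
     = {monomial (xexp i + xexp (i + 1)) | i. 1 \<le> i \<and> i < n}"
  unfolding path_edges_def var_mult_var
  by (auto simp: doubleton_eq_iff) (metis add.commute)

lemma path_generators_in_order_ideal:
  assumes "\<And>i. c \<le> degree_in A (xexp i + xexp (i + 1))"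
  shows "{var i * var j | i j. {i, j} \<in> path_edges n} \<subseteq> order_ideal n A c"
  unfolding path_edge_generators
  using assms by (auto simp: order_ideal_def in_poly_ring keys_add_nat)

lemma path_edge_ideal_subset_order_ideal:
  assumes "\<And>i. c \<le> degree_in A (xexp i + xexp (i + 1))"
  shows "edge_ideal n (path_edges n) \<subseteq> (order_ideal n A c :: 'k::field mpoly set)"
proof -
  interpret R: cring "poly_ring n :: 'k mpoly ring" by (rule cring_poly_ring)
  show ?thesis
    unfolding edge_ideal_def
    by (intro R.genideal_minimal ideal_order_ideal path_generators_in_order_ideal assms)
qed

lemma path_generators_in_carrier:
  "{var i * var j | i j. {i, j} \<in> path_edges n} \<subseteq> carrier (poly_ring n)"
  using path_generators_in_order_ideal[of 0 UNIV n] by (auto simp: order_ideal_0)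

lemma ideal_path_edge_ideal:
  "ideal (edge_ideal n (path_edges n) :: 'k::field mpoly set) (poly_ring n)"
proof -
  interpret R: cring "poly_ring n :: 'k mpoly ring" by (rule cring_poly_ring)
  show ?thesis unfolding edge_ideal_def by (rule R.genideal_ideal[OF path_generators_in_carrier])
qed

lemma edge_mem_path_edge_ideal:
  assumes "1 \<le> i" "i < n"
  shows "monomial (xexp i + xexp (i + 1)) \<in> (edge_ideal n (path_edges n) :: 'k::field mpoly set)"
proof -
  interpret R: cring "poly_ring n :: 'k mpoly ring" by (rule cring_poly_ring)
  have "monomial (xexp i + xexp (i + 1)) \<in> {var i * var j | i j. {i, j} \<in> path_edges n}"
    unfolding path_edge_generators using assms by blast
  then show ?thesis
    unfolding edge_ideal_def using R.genideal_self[OF path_generators_in_carrier] by blast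
qed

text \<open>The exponent of \<open>x\<^sub>c \<cdot> (x\<^sub>2 x\<^sub>c)\<^sup>a \<cdot> (x\<^sub>4 x\<^sub>5) \<cdots> (x\<^bsub>2s+2\<^esub> x\<^bsub>2s+3\<^esub>)\<close>.\<close>

definition witness_exp :: "nat \<Rightarrow> nat \<Rightarrow> nat \<Rightarrow> (nat \<Rightarrow>\<^sub>0 nat)"
  where "witness_exp c a s =
    xexp c + (\<Sum>i<a. xexp 2 + xexp c) + (\<Sum>i<s. xexp (2 * i + 4) + xexp (2 * i + 5))"

lemma witness_exp_Suc:
  "witness_exp c a (Suc s) = witness_exp c a s + (xexp (2 * s + 4) + xexp (2 * s + 5))"
  by (simp add: witness_exp_def add.assoc)

lemma degree_in_witness_exp:
  "degree_in UNIV (witness_exp c a s) = 2 * (a + s) + 1"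
  "odd c \<Longrightarrow> degree_in {i. even i} (witness_exp c a s) = a + s"
  unfolding witness_exp_def by (simp_all only: degree_in_add degree_in_sum degree_in_xexp) simp_all

lemma keys_witness_exp:
  assumes "2 \<le> n" "c \<in> {1..n}" "s = 0 \<or> 2 * s + 3 \<le> n"
  shows "Poly_Mapping.keys (witness_exp c a s) \<subseteq> {1..n}"
  using assms(3)
proof (induction s)
  case 0
  have "Poly_Mapping.keys (\<Sum>i<a. xexp 2 + xexp c) \<subseteq> {1..n}"
    using assms(1,2) by (induction a) (auto simp: keys_add_nat simp del: sum_constant)
  then show ?case using assms(2) by (auto simp: witness_exp_def keys_add_nat simp del: sum_constant)
next
  case (Suc s)
  then show ?case by (auto simp: witness_exp_Suc keys_add_nat)
qed

text \<open>Induction on the number \<open>s\<close> of trailing pairs. The new pair \<open>x\<^bsub>2s+4\<^esub> x\<^bsub>2s+5\<^esub>\<close> is itself an edge,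
  which settles all even variables treated before. For the new even variable \<open>x\<^bsub>2s+6\<^esub>\<close> the pair is
  taken apart: \<open>x\<^bsub>2s+5\<^esub> x\<^bsub>2s+6\<^esub>\<close> is an edge and the remaining \<open>x\<^bsub>2s+4\<^esub>\<close> is the last even variable
  treated before.\<close>

lemma even_var_times_witness:
  assumes c: "c = 3 \<and> 3 \<le> n \<or> c = 1 \<and> n < 4"
    and "1 \<le> j" "j \<le> s + 2" "2 * j \<le> n" "s = 0 \<or> 2 * s + 3 \<le> n"
  shows "monomial (xexp (2 * j) + witness_exp c a s)
    \<in> (ideal_power n (edge_ideal n (path_edges n)) (Suc (a + s)) :: 'k::field mpoly set)"
  using assms(2-)
proof (induction s arbitrary: j)
  let ?I = "edge_ideal n (path_edges n) :: 'k mpoly set"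
  let ?pow = "ideal_power n ?I"
  have extend: "monomial (\<mu> + \<nu>) \<in> ?pow (Suc k)"
    if "monomial \<mu> \<in> ?pow k" "monomial \<nu> \<in> ?I" for \<mu> \<nu> k
    using mult_mem_ideal_power_Suc[OF that] by (simp add: mult_single)
  {
    case 0
    have edge: "monomial (xexp 2 + xexp c) \<in> ?I"
      using c
    proof
      assume "c = 3 \<and> 3 \<le> n"
      then show ?thesis using edge_mem_path_edge_ideal[of 2 n] by simp
    next
      assume "c = 1 \<and> n < 4"
      then show ?thesis
        using edge_mem_path_edge_ideal[of 1 n] 0 by (simp add: add.commute numeral_2_eq_2)
    qed
    have rep: "monomial (\<Sum>i<a. xexp 2 + xexp c) \<in> ?pow a"
    proof (induction a)
      case 0
      then show ?case by (simp add: ideal_power_0 in_poly_ring)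
    next
      case (Suc a)
      then show ?case using extend[OF Suc edge] by (simp add: add.commute del: sum_constant)
    qed
    have "monomial (xexp (2 * j) + xexp c) \<in> ?I"
    proof (cases "j = 1")
      case True
      then show ?thesis using edge by simp
    next
      case False
      then have "j = 2" "c = 3" "4 \<le> n" using 0 c by auto
      then show ?thesis using edge_mem_path_edge_ideal[of 3 n] by (simp add: add.commute)
    qed
    from extend[OF rep this] show ?case by (simp add: witness_exp_def ac_simps del: sum_constant)
  next
    case (Suc s)
    show ?case
    proof (cases "j \<le> s + 2")
      case True
      have "monomial (xexp (2 * j) + witness_exp c a s) \<in> ?pow (Suc (a + s))"
        using Suc True by auto
      moreover have "monomial (xexp (2 * s + 4) + xexp (2 * s + 5)) \<in> ?I"
        using edge_mem_path_edge_ideal[of "2 * s + 4" n] Suc.prems by (simp add: add.commute)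
      ultimately show ?thesis using extend by (fastforce simp: witness_exp_Suc add.assoc)
    next
      case False
      then have j: "j = s + 3" using Suc.prems by simp
      have "monomial (xexp (2 * (s + 2)) + witness_exp c a s) \<in> ?pow (Suc (a + s))"
        using Suc.prems by (intro Suc.IH) auto
      moreover have "monomial (xexp (2 * s + 5) + xexp (2 * s + 6)) \<in> ?I"
        using edge_mem_path_edge_ideal[of "2 * s + 5" n] Suc.prems j by (simp add: add.commute)
      moreover have "xexp (2 * j) + witness_exp c a (Suc s)
          = (xexp (2 * (s + 2)) + witness_exp c a s) + (xexp (2 * s + 5) + xexp (2 * s + 6))"
      proof -
        have "2 * j = 2 * s + 6" "2 * (s + 2) = 2 * s + 4" using j by simp_all
        then show ?thesis by (simp only: witness_exp_Suc ac_simps)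
      qed
      ultimately show ?thesis using extend by (metis add_Suc_right)
    qed
  }
qed

section \<open>The v-number\<close>

theorem corollary5p6:
  fixes n k :: nat and I :: "'k::field mpoly set"
  assumes "n \<ge> 2"
    and "I = edge_ideal n (path_edges n)"
    and "k \<ge> 1"
    and "k \<ge> n div 2 - 1"
  shows "v_number n (ideal_power n I k) = 2 * k - 1"
proof -
  let ?R = "poly_ring n :: 'k mpoly ring" and ?J = "ideal_power n I k"
  let ?even = "{i :: nat. even i}"
  have idl: "ideal I ?R" using assms(2) ideal_path_edge_ideal by simp
  have J: "ideal ?J ?R" by (rule ideal_ideal_power[OF idl])
  define s where "s = n div 2 - 2"
  define a where "a = k - 1 - s"
  \<comment> \<open>For \<open>n \<le> 3\<close> the number \<open>s\<close> of trailing pairs is truncated to \<open>0\<close>, the only even vertex is \<open>2\<close>, and \<open>n = 2\<close> leaves \<open>1\<close> as its only neighbour.\<close>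
  define c :: nat where "c = (if n \<ge> 4 then 3 else 1)"
  define \<mu> where "\<mu> = witness_exp c a s"
  have k: "k = Suc (a + s)" and s: "s = 0 \<or> 2 * s + 3 \<le> n"
    using assms(3,4) by (auto simp: a_def s_def)
  have c: "c = 3 \<and> 3 \<le> n \<or> c = 1 \<and> n < 4" "odd c" "c \<in> {1..n}"
    using assms(1) by (auto simp: c_def)
  have \<mu>n: "Poly_Mapping.keys \<mu> \<subseteq> {1..n}"
    unfolding \<mu>_def using keys_witness_exp[OF assms(1) c(3) s] .
  have deg: "monom_degree \<mu> = 2 * k - 1" "degree_in ?even \<mu> = a + s"
    using degree_in_witness_exp(1)[of c a s] degree_in_witness_exp(2)[OF c(2), of a s]
    by (simp_all add: \<mu>_def k degree_in_UNIV)
  have sub1: "I \<subseteq> order_ideal n ?even 1" and sub2: "I \<subseteq> order_ideal n UNIV 2"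
    unfolding assms(2)
    by (rule path_edge_ideal_subset_order_ideal; unfold degree_in_add degree_in_xexp; simp)+
  have "colon ?R ?J (monomial \<mu>) = order_ideal n ?even 1"
  proof (rule colon_eq_order_ideal_1[OF J _ \<mu>n])
    show "?J \<subseteq> order_ideal n ?even (Suc (degree_in ?even \<mu>))"
      using ideal_power_subset_order_ideal[OF sub1, of k] by (simp add: deg k)
    fix i assume "i \<in> ?even" "i \<in> {1..n}"
    then obtain j where j: "i = 2 * j" "1 \<le> j" "2 * j \<le> n" by (auto elim!: evenE)
    then have "j \<le> s + 2" by (simp add: s_def)
    then show "monomial (xexp i + \<mu>) \<in> ?J"
      using even_var_times_witness[OF c(1) j(2) _ j(3) s, of a] j(1)
      by (simp add: \<mu>_def k assms(2))
  qed
  then have prime: "primeideal (colon ?R ?J (monomial \<mu>)) ?R"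
    using primeideal_order_ideal_1 by simp
  have f: "monomial \<mu> \<in> (graded_part n (2 * k - 1) :: 'k mpoly set)"
    using \<mu>n deg(1) by (simp add: graded_part_def in_poly_ring)
  show ?thesis
    unfolding v_number_def
  proof (rule Least_equality)
    have "colon ?R ?J (monomial \<mu>) \<in> assoc_primes ?R ?J"
      using f by (intro prime_colon_in_assoc_primes cring_poly_ring J prime)
        (simp add: graded_part_def)
    then show "\<exists>f \<in> graded_part n (2 * k - 1). \<exists>P \<in> assoc_primes ?R ?J. colon ?R ?J f = P"
      using f by blast
  next
    fix d assume "\<exists>f \<in> graded_part n d. \<exists>P \<in> assoc_primes ?R ?J. colon ?R ?J f = P"
    then obtain f where fd: "f \<in> graded_part n d" and "primeideal (colon ?R ?J f) ?R"
      by (auto simp: assoc_primes_def)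
    moreover have "var 1 * var 2 \<in> I"
      using edge_mem_path_edge_ideal[of 1 n] assms(1)
      by (simp add: var_mult_var assms(2) numeral_2_eq_2)
    ultimately have "2 * k \<le> d + 1"
      using assms(1) by (intro prime_colon_degree_bound[OF idl sub2, of 1 2]) auto
    then show "2 * k - 1 \<le> d" by simp
  qed
qed

end
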